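(* Let $A:\mathbb{R}^n\to\mathbb{R}^{n\times n}$ and $B:\mathbb{R}^n\to\mathbb{R}^{n\times m}$ be continuous, let $\bar\gamma>0$, and let $t\ge1$. Suppose that the program $\mathrm{SDP}_{t-1}$ (defined in the context) at $x_{t-1}$ is feasible, and let $(Y(x_{t-1}),P(x_{t-1}),L(x_{t-1}),\gamma(x_{t-1}))$ be its corresponding optimal solution. Let $x_t$ be the next state, $x_t=(A(x_{t-1})+B(x_{t-1})Y(x_{t-1})P(x_{t-1})^{-1})x_{t-1}$. Define $$Z_{s}:=\begin{bmatrix}A(x_s)&B(x_s)\end{bmatrix}\ (s=t-1,t),\qquad R_{t-1}:=Z_t-Z_{t-1},$$ $$M_{t-1}:=\begin{bmatrix} P(x_{t-1}) \\ {Y}(x_{t-1}) \end{bmatrix}P(x_{t-1})^{-1}\begin{bmatrix} P(x_{t-1}) \\ {Y}(x_{t-1}) \end{bmatrix}^\top,$$ $$\Psi_{t-1}:=R_{t-1}M_{t-1}R_{t-1}^\top+Z_{t-1}M_{t-1}R_{t-1}^\top+R_{t-1}M_{t-1}Z_{t-1}^\top .$$ If $$\Psi_{t-1}\preceq\Bigl(1-\frac{\gamma(x_{t-1})}{\bar\gamma}\Bigr)I,$$ then, with $\eta_{t-1}:=\bar\gamma/\gamma(x_{t-1})$, the tuple $$\eta_{t-1}\,(Y(x_{t-1}),P(x_{t-1}),L(x_{t-1}),\gamma(x_{t-1}))$$ is a feasible solution of the program $\mathrm{SDP}_t$ at $x_t$ (built with the matrix $P(x_{t-1})$).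
   Context: $\mathbb{S}^{n\times n}$ is the set of real symmetric $n\times n$ matrices; $\succ,\succeq,\preceq$ denote (semi)definiteness order of symmetric matrices. The underlying system is $x_{t+1}=A(x_t)x_t+B(x_t)u_t$ with control $u_t=Y(x_t)P(x_t)^{-1}x_t$. For $t\ge 1$, given $x_t\in\mathbb{R}^n$ and $P(x_{t-1})\succ0$, the program $\mathrm{SDP}_t$ has decision variables $Y\in\mathbb{R}^{m\times n}$, $P\in\mathbb{S}^{n\times n}$, $L\in\mathbb{S}^{m\times m}$, $\gamma\in\mathbb{R}$ (optimal values are denoted $Y(x_t),P(x_t),L(x_t),\gamma(x_t)$): minimize $\gamma$ subject to 1. $\begin{bmatrix}P-I & A(x_t)P+B(x_t)Y \\ (A(x_t)P+B(x_t)Y)^\top & P\end{bmatrix}\succeq0$, 2. $\begin{bmatrix} L & Y \\ {Y}^\top & P \end{bmatrix}\succeq0$, 3. $\gamma\ge\operatorname{tr}P+\operatorname{tr}L$, 4. $\begin{bmatrix}x_t^\top P(x_{t-1})^{-1}x_t & x_t^\top \\ x_t & P\end{bmatrix}\succeq0$, 5. $\gamma\le\bar\gamma$. For $t=0$, the program $\mathrm{SDP}_0$ at $x_0$ is the same problem with constraints 4 and 5 omitted. Constraint 1 forces $P\succeq I$, so $P$ is invertible.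
   Formalization: For t = 1 the assumption γ(x_0) ≤ γ̄ is added, since SDP_0 lacks constraint 5; without it the claim fails, e.g. n = m = 1, A(x) = x − 1/2, B = 0, x_0 = 1, γ̄ = 1, where constraint 4 of SDP_1 is violated. *)

theory Defs
  imports "HOL-Analysis.Analysis"
begin

definition psd :: "real^'k^'k \<Rightarrow> bool" where
  "psd X \<longleftrightarrow> transpose X = X \<and> (\<forall>v. 0 \<le> v \<bullet> (X *v v))"

definition pos_def :: "real^'k^'k \<Rightarrow> bool" where
  "pos_def X \<longleftrightarrow> transpose X = X \<and> (\<forall>v. v \<noteq> 0 \<longrightarrow> 0 < v \<bullet> (X *v v))"

definition loewner_le :: "real^'k^'k \<Rightarrow> real^'k^'k \<Rightarrow> bool" (infix "\<preceq>\<^sub>L" 50) where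
  "X \<preceq>\<^sub>L W \<longleftrightarrow> psd (W - X)"

text \<open>Block matrices are indexed by sum types. Recall that \<open>real^'c^'r\<close> has rows indexed
  by \<open>'r\<close> and columns indexed by \<open>'c\<close>.\<close>

definition hcat :: "real^'c^'r \<Rightarrow> real^'d^'r \<Rightarrow> real^('c + 'd)^'r" where
  "hcat X W = (\<chi> i j. case j of Inl k \<Rightarrow> X $ i $ k | Inr k \<Rightarrow> W $ i $ k)"

definition vcat :: "real^'c^'r \<Rightarrow> real^'c^'s \<Rightarrow> real^'c^('r + 's)" where
  "vcat X W = (\<chi> i. case i of Inl k \<Rightarrow> X $ k | Inr k \<Rightarrow> W $ k)"

definition block ::
  "real^'c^'r \<Rightarrow> real^'d^'r \<Rightarrow> real^'c^'s \<Rightarrow> real^'d^'s \<Rightarrow> real^('c + 'd)^('r + 's)" where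
  "block X\<^sub>1\<^sub>1 X\<^sub>1\<^sub>2 X\<^sub>2\<^sub>1 X\<^sub>2\<^sub>2 = vcat (hcat X\<^sub>1\<^sub>1 X\<^sub>1\<^sub>2) (hcat X\<^sub>2\<^sub>1 X\<^sub>2\<^sub>2)"

text \<open>The feasible set and the set of optimal solutions of the program at time \<open>t\<close> and state
  \<open>x\<close>; decision variables are ordered \<open>(Y, P, L, \<gamma>)\<close>. The argument \<open>Pp\<close> is the matrix obtained
  at the previous time step; it is ignored for \<open>t = 0\<close>. Scalar blocks are 1-by-1 matrices.\<close>

definition sdp_feasible ::
  "(real^'n \<Rightarrow> real^'n^'n) \<Rightarrow> (real^'n \<Rightarrow> real^'m^'n) \<Rightarrow> real \<Rightarrow> nat \<Rightarrow> real^'n \<Rightarrow> real^'n^'n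
    \<Rightarrow> ((real^'n^'m) \<times> (real^'n^'n) \<times> (real^'m^'m) \<times> real) set" where
  "sdp_feasible A B \<gamma>bar t x Pp = {(Y, P, L, \<gamma>).
     transpose P = P \<and> transpose L = L \<and>
     psd (block (P - mat 1) (A x ** P + B x ** Y) (transpose (A x ** P + B x ** Y)) P) \<and>
     psd (block L Y (transpose Y) P) \<and>
     \<gamma> \<ge> trace P + trace L \<and>
     (t \<ge> 1 \<longrightarrow>
       psd (block (rowvector x ** matrix_inv Pp ** columnvector x :: real^1^1)
                  (rowvector x) (columnvector x) P) \<and>
       \<gamma> \<le> \<gamma>bar)}"

definition sdp_optimal ::
  "(real^'n \<Rightarrow> real^'n^'n) \<Rightarrow> (real^'n \<Rightarrow> real^'m^'n) \<Rightarrow> real \<Rightarrow> nat \<Rightarrow> real^'n \<Rightarrow> real^'n^'n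
    \<Rightarrow> ((real^'n^'m) \<times> (real^'n^'n) \<times> (real^'m^'m) \<times> real) set" where
  "sdp_optimal A B \<gamma>bar t x Pp = {(Y, P, L, \<gamma>).
     (Y, P, L, \<gamma>) \<in> sdp_feasible A B \<gamma>bar t x Pp \<and>
     (\<forall>(Y', P', L', \<gamma>') \<in> sdp_feasible A B \<gamma>bar t x Pp. \<gamma> \<le> \<gamma>')}"

end

theory Submission
  imports Defs
begin

text \<open>
  Write \<open>P, Y, L, \<gamma>\<close> for the optimal solution at time \<open>t - 1\<close>, \<open>N\<close> for the matrix \<open>P\<close> stacked on
  \<open>Y\<close>, and \<open>\<eta> = \<gamma>bar / \<gamma>\<close>. The first constraint has off-diagonal block \<open>A P + B Y = Z N\<close>, so a
  Schur complement (\<open>psd_block_iff_psd_schur_complement\<close>) turns it into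
  \<open>Z M Z\<^sup>T \<preceq> P - I\<close> with \<open>M = N P\<^sup>-\<^sup>1 N\<^sup>T\<close>. This form shows how a change of the system matrices acts:
  the perturbation \<open>\<Psi>\<close> is exactly the difference \<open>Z\<^sub>t M Z\<^sub>t\<^sup>T - Z\<^sub>t\<^sub>-\<^sub>1 M Z\<^sub>t\<^sub>-\<^sub>1\<^sup>T\<close>
  (\<open>congruence_perturbation\<close>). Scaling the decision variables by \<open>\<eta>\<close> multiplies \<open>P\<close> and
  \<open>Z\<^sub>t M Z\<^sub>t\<^sup>T\<close> by \<open>\<eta>\<close> but leaves \<open>I\<close> alone, and therefore creates a slack. The scaled first
  constraint at time \<open>t\<close> reads \<open>\<eta> (P - Z\<^sub>t M Z\<^sub>t\<^sup>T) - I \<succeq> 0\<close>, and its left side is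
  \<open>\<eta> ((P - I - Z\<^sub>t\<^sub>-\<^sub>1 M Z\<^sub>t\<^sub>-\<^sub>1\<^sup>T) + ((1 - 1 / \<eta>) I - \<Psi>))\<close>. Here the first summand is positive
  semidefinite by feasibility at time \<open>t - 1\<close>, and the second one by the hypothesis on \<open>\<Psi>\<close>.

  The remaining constraints follow from \<open>0 < \<gamma> \<le> \<gamma>bar\<close>, which gives \<open>\<eta> \<ge> 1\<close>. Positivity of \<open>\<gamma>\<close>
  follows from \<open>\<gamma> \<ge> tr P + tr L\<close> together with \<open>P \<succeq> I\<close> and \<open>L \<succeq> 0\<close>. The second and third constraint are homogeneous, and \<open>\<eta> \<gamma> = \<gamma>bar\<close>. The Schur complement
  of the fourth is \<open>(1 - 1 / \<eta>) x\<^sub>t\<^sup>T P\<^sup>-\<^sup>1 x\<^sub>t \<ge> 0\<close>.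
\<close>

section \<open>Positive semidefinite matrices\<close>

lemma transpose_diff: "transpose (X - W) = transpose X - transpose (W :: real^'a^'b)"
  by (simp add: transpose_def vec_eq_iff)

lemma transpose_add: "transpose (X + W) = transpose X + transpose (W :: real^'a^'b)"
  by (simp add: transpose_def vec_eq_iff)

lemma matrix_add_rdistrib: "(X + W) ** U = X ** U + W ** (U :: real^'c^'a)"
  by (simp add: matrix_matrix_mult_def vec_eq_iff sum.distrib distrib_right)

lemma inner_transpose_mult_vec:
  fixes X :: "real^'a^'b"
  shows "w \<bullet> (transpose X *v u) = u \<bullet> (X *v w)"
  by (metis dot_lmul_matrix inner_commute vector_transpose_matrix)

lemma psd_add: "psd X \<Longrightarrow> psd W \<Longrightarrow> psd (X + W)"
  by (simp add: psd_def transpose_add matrix_vector_mult_add_rdistrib inner_add_right)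

lemma psd_scaleR: "psd X \<Longrightarrow> 0 \<le> c \<Longrightarrow> psd (c *\<^sub>R X)"
  by (simp add: psd_def transpose_scalar scaleR_matrix_vector_assoc[symmetric])

lemma psd_congruence:
  assumes "psd X"
  shows "psd (W ** X ** transpose W)"
  unfolding psd_def
proof (intro conjI allI)
  show "transpose (W ** X ** transpose W) = W ** X ** transpose W"
    using assms by (simp add: psd_def matrix_transpose_mul matrix_mul_assoc)
  fix v
  have "v \<bullet> ((W ** X ** transpose W) *v v) = (transpose W *v v) \<bullet> (X *v (transpose W *v v))"
    by (metis inner_transpose_mult_vec inner_commute matrix_vector_mul_assoc)
  then show "0 \<le> v \<bullet> ((W ** X ** transpose W) *v v)"
    using assms by (simp add: psd_def)
qed

lemma trace_nonneg_if_psd: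
  fixes X :: "real^'a^'a"
  assumes "psd X"
  shows "0 \<le> trace X"
proof -
  have "0 \<le> X $ i $ i" for i
  proof -
    have "0 \<le> axis i 1 \<bullet> (X *v axis i 1)"
      using assms by (simp add: psd_def)
    then show ?thesis
      by (simp add: inner_axis' matrix_vector_mult_basis column_def)
  qed
  then show ?thesis
    by (simp add: trace_def sum_nonneg)
qed

lemma pos_def_if_psd_diff_one:
  fixes Q :: "real^'a^'a"
  assumes "psd (Q - mat 1)"
  shows "pos_def Q"
  unfolding pos_def_def
proof (intro conjI allI impI)
  have "transpose Q - mat 1 = Q - mat 1"
    using assms by (simp add: psd_def transpose_diff)
  then show "transpose Q = Q"
    by simp
  fix v :: "real^'a" assume "v \<noteq> 0"
  moreover have "0 \<le> v \<bullet> (Q *v v) - v \<bullet> v"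
    using assms by (simp add: psd_def matrix_vector_mult_diff_rdistrib inner_diff_right)
  ultimately show "0 < v \<bullet> (Q *v v)"
    using inner_gt_zero_iff[of v] by linarith
qed

lemma pos_def_scaleR: "pos_def Q \<Longrightarrow> 0 < c \<Longrightarrow> pos_def (c *\<^sub>R Q)"
  by (simp add: pos_def_def transpose_scalar scaleR_matrix_vector_assoc[symmetric])

section \<open>Inverses of positive definite matrices\<close>

lemma matrix_inv_unique:
  fixes Q W :: "real^'a^'a"
  assumes "Q ** W = mat 1"
  shows "matrix_inv Q = W"
proof -
  have "W ** Q = mat 1"
    using assms by (simp add: matrix_left_right_inverse)
  then have "Q ** matrix_inv Q = mat 1 \<and> matrix_inv Q ** Q = mat 1"
    unfolding matrix_inv_def using assms
    by (intro someI_ex[of "\<lambda>V. Q ** V = mat 1 \<and> V ** Q = mat 1"]) auto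
  with \<open>W ** Q = mat 1\<close> show ?thesis
    by (metis matrix_mul_assoc matrix_mul_lid matrix_mul_rid)
qed

lemma pos_def_matrix_inv_right:
  fixes Q :: "real^'a^'a"
  assumes "pos_def Q"
  shows "Q ** matrix_inv Q = mat 1"
proof -
  have "v = 0" if "Q *v v = 0" for v
    using assms that by (metis pos_def_def inner_zero_right less_irrefl)
  then obtain W where "W ** Q = mat 1"
    using matrix_left_invertible_ker[of Q] by blast
  then show ?thesis
    using matrix_inv_unique matrix_left_right_inverse by metis
qed

lemma matrix_inv_scaleR:
  fixes Q :: "real^'a^'a"
  assumes "pos_def Q" and "c \<noteq> 0"
  shows "matrix_inv (c *\<^sub>R Q) = (1 / c) *\<^sub>R matrix_inv Q"
  using assms
  by (intro matrix_inv_unique)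
    (simp add: matrix_scalar_ac scalar_matrix_assoc[symmetric] pos_def_matrix_inv_right)

lemma psd_matrix_inv:
  fixes Q :: "real^'a^'a"
  assumes "pos_def Q"
  shows "psd (matrix_inv Q)"
proof -
  have inv: "Q ** matrix_inv Q = mat 1"
    using assms by (rule pos_def_matrix_inv_right)
  have sym: "transpose (matrix_inv Q) = matrix_inv Q"
  proof -
    have "transpose (matrix_inv Q) ** Q = mat 1"
      using inv assms by (metis matrix_transpose_mul pos_def_def transpose_mat)
    then show ?thesis
      by (metis matrix_inv_unique matrix_left_right_inverse)
  qed
  have "psd Q"
    using assms unfolding psd_def pos_def_def
    by (metis inner_zero_left less_eq_real_def)
  then have "psd (matrix_inv Q ** Q ** transpose (matrix_inv Q))"
    by (rule psd_congruence)
  then show ?thesis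
    by (simp add: sym matrix_mul_assoc[symmetric] inv)
qed

section \<open>Block matrices and Schur complements\<close>

lemma hcat_mult_vcat:
  fixes X :: "real^'a^'r" and W :: "real^'b^'r" and U :: "real^'c^'a" and V :: "real^'c^'b"
  shows "hcat X W ** vcat U V = X ** U + W ** V"
  by (simp add: vec_eq_iff hcat_def vcat_def matrix_matrix_mult_def
      UNIV_Plus_UNIV[symmetric] sum.Plus del: UNIV_Plus_UNIV)

lemma scaleR_block:
  "c *\<^sub>R block X\<^sub>1\<^sub>1 X\<^sub>1\<^sub>2 X\<^sub>2\<^sub>1 X\<^sub>2\<^sub>2 = block (c *\<^sub>R X\<^sub>1\<^sub>1) (c *\<^sub>R X\<^sub>1\<^sub>2) (c *\<^sub>R X\<^sub>2\<^sub>1) (c *\<^sub>R X\<^sub>2\<^sub>2)"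
  by (simp add: block_def vcat_def hcat_def vec_eq_iff split: sum.split)

lemma transpose_block:
  "transpose (block X\<^sub>1\<^sub>1 X\<^sub>1\<^sub>2 X\<^sub>2\<^sub>1 X\<^sub>2\<^sub>2)
    = block (transpose X\<^sub>1\<^sub>1) (transpose X\<^sub>2\<^sub>1) (transpose X\<^sub>1\<^sub>2) (transpose X\<^sub>2\<^sub>2)"
  by (simp add: block_def vcat_def hcat_def transpose_def vec_eq_iff split: sum.split)

lemma block_eq_iff:
  "block X\<^sub>1\<^sub>1 X\<^sub>1\<^sub>2 X\<^sub>2\<^sub>1 X\<^sub>2\<^sub>2 = block W\<^sub>1\<^sub>1 W\<^sub>1\<^sub>2 W\<^sub>2\<^sub>1 W\<^sub>2\<^sub>2
    \<longleftrightarrow> X\<^sub>1\<^sub>1 = W\<^sub>1\<^sub>1 \<and> X\<^sub>1\<^sub>2 = W\<^sub>1\<^sub>2 \<and> X\<^sub>2\<^sub>1 = W\<^sub>2\<^sub>1 \<and> X\<^sub>2\<^sub>2 = W\<^sub>2\<^sub>2"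
  by (auto simp: block_def vcat_def hcat_def vec_eq_iff split_sum_all)

lemma inner_block_mult_vec:
  fixes X\<^sub>1\<^sub>1 :: "real^'a^'a" and X\<^sub>2\<^sub>2 :: "real^'b^'b" and v :: "real^('a + 'b)"
  defines "u \<equiv> \<chi> i. v $ Inl i" and "w \<equiv> \<chi> j. v $ Inr j"
  shows "v \<bullet> (block X\<^sub>1\<^sub>1 X\<^sub>1\<^sub>2 X\<^sub>2\<^sub>1 X\<^sub>2\<^sub>2 *v v)
    = u \<bullet> (X\<^sub>1\<^sub>1 *v u) + u \<bullet> (X\<^sub>1\<^sub>2 *v w) + w \<bullet> (X\<^sub>2\<^sub>1 *v u) + w \<bullet> (X\<^sub>2\<^sub>2 *v w)"
  by (simp add: u_def w_def block_def vcat_def hcat_def matrix_vector_mult_def inner_vec_def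
      UNIV_Plus_UNIV[symmetric] sum.Plus sum.distrib distrib_left del: UNIV_Plus_UNIV)

lemma psd_block_iff:
  fixes X :: "real^'a^'a" and V :: "real^'b^'a" and Q :: "real^'b^'b"
  shows "psd (block X V (transpose V) Q) \<longleftrightarrow>
    transpose X = X \<and> transpose Q = Q \<and>
    (\<forall>u w. 0 \<le> u \<bullet> (X *v u) + 2 * (u \<bullet> (V *v w)) + w \<bullet> (Q *v w))"
    (is "_ \<longleftrightarrow> _ \<and> _ \<and> (\<forall>u w. 0 \<le> ?q u w)")
proof -
  have form: "v \<bullet> (block X V (transpose V) Q *v v) = ?q (\<chi> i. v $ Inl i) (\<chi> j. v $ Inr j)" for v
    unfolding inner_block_mult_vec inner_transpose_mult_vec by simp
  have "(\<forall>v. 0 \<le> v \<bullet> (block X V (transpose V) Q *v v)) \<longleftrightarrow> (\<forall>u w. 0 \<le> ?q u w)"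
  proof (intro iffI allI)
    fix u w
    assume "\<forall>v. 0 \<le> v \<bullet> (block X V (transpose V) Q *v v)"
    then have "0 \<le> (\<chi> i. case i of Inl k \<Rightarrow> u $ k | Inr k \<Rightarrow> w $ k) \<bullet> (block X V (transpose V) Q
      *v (\<chi> i. case i of Inl k \<Rightarrow> u $ k | Inr k \<Rightarrow> w $ k))"
      by blast
    then show "0 \<le> ?q u w"
      by (simp add: form)
  qed (simp add: form)
  then show ?thesis
    by (auto simp: psd_def transpose_block block_eq_iff)
qed

lemma psd_upper_left_block:
  fixes X :: "real^'a^'a" and V :: "real^'b^'a" and Q :: "real^'b^'b"
  assumes "psd (block X V (transpose V) Q)"
  shows "psd X"
proof -
  have "0 \<le> u \<bullet> (X *v u)" for u
  proof -
    have "0 \<le> u \<bullet> (X *v u) + 2 * (u \<bullet> (V *v 0)) + 0 \<bullet> (Q *v 0)"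
      using assms unfolding psd_block_iff by blast
    then show ?thesis
      by simp
  qed
  moreover have "transpose X = X"
    using assms by (simp add: psd_block_iff)
  ultimately show ?thesis
    by (simp add: psd_def)
qed

text \<open>
  Completing the square, the quadratic form of the block matrix at \<open>(u, w)\<close> is the form of the Schur
  complement at \<open>u\<close> plus the form of \<open>Q\<close> at \<open>w + Q\<^sup>-\<^sup>1 V\<^sup>T u\<close>. The last term is nonnegative, and it
  vanishes for \<open>w = - Q\<^sup>-\<^sup>1 V\<^sup>T u\<close>.
\<close>

lemma psd_block_iff_psd_schur_complement:
  fixes X :: "real^'a^'a" and V :: "real^'b^'a" and Q :: "real^'b^'b"
  assumes "pos_def Q"
  shows "psd (block X V (transpose V) Q) \<longleftrightarrow> psd (X - V ** matrix_inv Q ** transpose V)"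
proof -
  let ?S = "V ** matrix_inv Q ** transpose V"
  let ?z = "\<lambda>u. matrix_inv Q *v (transpose V *v u)"
  have Q: "transpose Q = Q" "0 \<le> w \<bullet> (Q *v w)" for w
    using assms unfolding pos_def_def by (simp, metis inner_zero_left less_eq_real_def)
  have S: "transpose ?S = ?S"
    using psd_congruence[OF psd_matrix_inv[OF assms], of V] by (simp add: psd_def)
  have Qz: "Q *v ?z u = transpose V *v u" for u
    by (simp add: matrix_vector_mul_assoc matrix_mul_assoc pos_def_matrix_inv_right[OF assms])
  have square: "u \<bullet> (X *v u) + 2 * (u \<bullet> (V *v w)) + w \<bullet> (Q *v w)
      = u \<bullet> ((X - ?S) *v u) + (w + ?z u) \<bullet> (Q *v (w + ?z u))" for u w
  proof -
    have "?z u \<bullet> (Q *v w) = u \<bullet> (V *v w)"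
      by (metis Q(1) Qz inner_transpose_mult_vec)
    moreover have "u \<bullet> (?S *v u) = ?z u \<bullet> (Q *v ?z u)"
      unfolding Qz inner_transpose_mult_vec by (simp only: matrix_vector_mul_assoc matrix_mul_assoc)
    moreover have "w \<bullet> (Q *v ?z u) = u \<bullet> (V *v w)"
      unfolding Qz by (rule inner_transpose_mult_vec)
    ultimately show ?thesis
      by (simp add: matrix_vector_right_distrib matrix_vector_mult_diff_rdistrib inner_diff_right
          inner_add_left inner_add_right)
  qed
  have "(\<forall>u w. 0 \<le> u \<bullet> (X *v u) + 2 * (u \<bullet> (V *v w)) + w \<bullet> (Q *v w))
      \<longleftrightarrow> (\<forall>u. 0 \<le> u \<bullet> ((X - ?S) *v u))"
  proof (intro iffI allI)
    fix u
    assume "\<forall>u w. 0 \<le> u \<bullet> (X *v u) + 2 * (u \<bullet> (V *v w)) + w \<bullet> (Q *v w)"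
    then have "0 \<le> u \<bullet> ((X - ?S) *v u) + (- ?z u + ?z u) \<bullet> (Q *v (- ?z u + ?z u))"
      unfolding square by blast
    then show "0 \<le> u \<bullet> ((X - ?S) *v u)"
      by simp
  next
    fix u w
    assume "\<forall>u. 0 \<le> u \<bullet> ((X - ?S) *v u)"
    then show "0 \<le> u \<bullet> (X *v u) + 2 * (u \<bullet> (V *v w)) + w \<bullet> (Q *v w)"
      unfolding square by (simp add: Q(2))
  qed
  then show ?thesis
    unfolding psd_block_iff by (auto simp: psd_def transpose_diff S Q(1))
qed

section \<open>Scaling a solution after a change of the system matrices\<close>

lemma congruence_perturbation:
  fixes Z R :: "real^'a^'b"
  shows "(Z + R) ** M ** transpose (Z + R) = Z ** M ** transpose Z
    + (R ** M ** transpose R + Z ** M ** transpose R + R ** M ** transpose Z)"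
  by (simp add: transpose_add matrix_add_ldistrib matrix_add_rdistrib)

text \<open>
  The change from \<open>V\<close> to \<open>V'\<close> enters the Schur complement only through \<open>E\<close>. The scaling makes up
  for it: dividing the scaled Schur complement by \<open>c\<close> replaces the term \<open>- I\<close> by \<open>- (1 / c) I\<close>,
  which leaves room for every \<open>E \<preceq> (1 - 1 / c) I\<close>.
\<close>

lemma psd_scaled_lyapunov_block:
  fixes Q :: "real^'a^'a" and V V' E :: "real^'a^'a"
  assumes Q: "pos_def Q" and c: "0 < c"
    and old: "psd (block (Q - mat 1) V (transpose V) Q)"
    and change: "V' ** matrix_inv Q ** transpose V' = V ** matrix_inv Q ** transpose V + E"
    and E: "psd ((1 - 1 / c) *\<^sub>R mat 1 - E)"
  shows "psd (block (c *\<^sub>R Q - mat 1) (c *\<^sub>R V') (transpose (c *\<^sub>R V')) (c *\<^sub>R Q))"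
proof -
  have "psd (Q - mat 1 - V ** matrix_inv Q ** transpose V)"
    using old by (simp add: psd_block_iff_psd_schur_complement[OF Q])
  then have "psd (c *\<^sub>R ((Q - mat 1 - V ** matrix_inv Q ** transpose V)
      + ((1 - 1 / c) *\<^sub>R mat 1 - E)))"
    using E c by (intro psd_scaleR psd_add) auto
  also have "c *\<^sub>R ((Q - mat 1 - V ** matrix_inv Q ** transpose V) + ((1 - 1 / c) *\<^sub>R mat 1 - E))
      = c *\<^sub>R Q - mat 1 - c *\<^sub>R (V' ** matrix_inv Q ** transpose V')"
    using c unfolding change by (simp add: algebra_simps)
  also have "c *\<^sub>R (V' ** matrix_inv Q ** transpose V')
      = (c *\<^sub>R V') ** matrix_inv (c *\<^sub>R Q) ** transpose (c *\<^sub>R V')"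
    using c by (simp add: matrix_inv_scaleR[OF Q] transpose_scalar matrix_scalar_ac
        scalar_matrix_assoc[symmetric])
  finally show ?thesis
    by (simp add: psd_block_iff_psd_schur_complement[OF pos_def_scaleR[OF Q c]])
qed

text \<open>
  The constraint says that the ellipsoid \<open>{z. z\<^sup>T (c Q)\<^sup>-\<^sup>1 z \<le> x\<^sup>T Q\<^sup>-\<^sup>1 x}\<close> contains \<open>x\<close>. For
  \<open>c = 1\<close> the point lies on the boundary, and a larger \<open>c\<close> can only enlarge the ellipsoid.
\<close>

lemma psd_ellipsoid_block:
  fixes Q :: "real^'a^'a" and x :: "real^'a"
  assumes Q: "pos_def Q" and c: "1 \<le> c"
  shows "psd (block (rowvector x ** matrix_inv Q ** columnvector x :: real^1^1)
    (rowvector x) (columnvector x) (c *\<^sub>R Q))"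
proof -
  let ?s = "rowvector x ** matrix_inv Q ** columnvector x :: real^1^1"
  have "psd ?s"
    using psd_congruence[OF psd_matrix_inv[OF Q], of "rowvector x"]
    by (simp add: transpose_rowvector)
  then have "psd ((1 - 1 / c) *\<^sub>R ?s)"
    using c by (intro psd_scaleR) auto
  also have "(1 - 1 / c) *\<^sub>R ?s
      = ?s - rowvector x ** matrix_inv (c *\<^sub>R Q) ** transpose (rowvector x)"
    using c by (simp add: matrix_inv_scaleR[OF Q] transpose_rowvector matrix_scalar_ac
        scalar_matrix_assoc[symmetric] algebra_simps)
  finally have "psd (block ?s (rowvector x) (transpose (rowvector x)) (c *\<^sub>R Q))"
    using c by (subst psd_block_iff_psd_schur_complement[OF pos_def_scaleR[OF Q]]) auto
  then show ?thesis
    by (simp add: transpose_rowvector)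
qed

theorem proposition4:
  fixes A :: "real^'n \<Rightarrow> real^'n^'n" and B :: "real^'n \<Rightarrow> real^'m^'n"
    and \<gamma>bar \<eta> :: real and t :: nat
    and x :: "nat \<Rightarrow> real^'n"
    and Y :: "nat \<Rightarrow> real^'n^'m" and P :: "nat \<Rightarrow> real^'n^'n"
    and L :: "nat \<Rightarrow> real^'m^'m" and \<gamma> :: "nat \<Rightarrow> real"
    and Z :: "nat \<Rightarrow> real^('n + 'm)^'n" and R :: "real^('n + 'm)^'n"
    and M :: "real^('n + 'm)^('n + 'm)" and \<Psi> :: "real^'n^'n"
  assumes "continuous_on UNIV A" and "continuous_on UNIV B"
    and "\<gamma>bar > 0" and "t \<ge> 1"
    and "t \<ge> 2 \<Longrightarrow> pos_def (P (t - 2))"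
    and "sdp_feasible A B \<gamma>bar (t - 1) (x (t - 1)) (P (t - 2)) \<noteq> {}"
    and "(Y (t - 1), P (t - 1), L (t - 1), \<gamma> (t - 1))
           \<in> sdp_optimal A B \<gamma>bar (t - 1) (x (t - 1)) (P (t - 2))"
    and "t = 1 \<Longrightarrow> \<gamma> 0 \<le> \<gamma>bar"
    and "x t = (A (x (t - 1)) + B (x (t - 1)) ** Y (t - 1) ** matrix_inv (P (t - 1))) *v x (t - 1)"
    and "\<And>s. Z s = hcat (A (x s)) (B (x s))"
    and "R = Z t - Z (t - 1)"
    and "M = vcat (P (t - 1)) (Y (t - 1)) ** matrix_inv (P (t - 1))
               ** transpose (vcat (P (t - 1)) (Y (t - 1)))"
    and "\<Psi> = R ** M ** transpose R + Z (t - 1) ** M ** transpose R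
               + R ** M ** transpose (Z (t - 1))"
    and "\<Psi> \<preceq>\<^sub>L (1 - \<gamma> (t - 1) / \<gamma>bar) *\<^sub>R mat 1"
    and "\<eta> = \<gamma>bar / \<gamma> (t - 1)"
  shows "\<eta> *\<^sub>R (Y (t - 1), P (t - 1), L (t - 1), \<gamma> (t - 1))
           \<in> sdp_feasible A B \<gamma>bar t (x t) (P (t - 1))"
proof -
  let ?A = "A (x (t - 1))" and ?B = "B (x (t - 1))" and ?P = "P (t - 1)" and ?Y = "Y (t - 1)"
    and ?L = "L (t - 1)" and ?\<gamma> = "\<gamma> (t - 1)"
  let ?N = "vcat ?P ?Y"
  have sol: "(?Y, ?P, ?L, ?\<gamma>) \<in> sdp_feasible A B \<gamma>bar (t - 1) (x (t - 1)) (P (t - 2))"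
    using assms(7) by (simp add: sdp_optimal_def)
  then have P_sym: "transpose ?P = ?P" and L_sym: "transpose ?L = ?L"
    and lyap: "psd (block (?P - mat 1) (?A ** ?P + ?B ** ?Y) (transpose (?A ** ?P + ?B ** ?Y)) ?P)"
    and cost: "psd (block ?L ?Y (transpose ?Y) ?P)" and trace: "trace ?P + trace ?L \<le> ?\<gamma>"
    by (simp_all add: sdp_feasible_def)
  have P_ge_1: "psd (?P - mat 1)"
    using lyap by (rule psd_upper_left_block)
  then have P_pos: "pos_def ?P"
    by (rule pos_def_if_psd_diff_one)
  have \<gamma>_pos: "0 < ?\<gamma>"
  proof -
    have "0 \<le> trace (?P - mat 1)"
      using P_ge_1 by (rule trace_nonneg_if_psd)
    then have "0 < trace ?P"
      by (simp add: trace_sub trace_I order_less_le_trans[of 0 "real CARD('n)"])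
    moreover have "0 \<le> trace ?L"
      using psd_upper_left_block[OF cost] by (rule trace_nonneg_if_psd)
    ultimately show ?thesis
      using trace by linarith
  qed
  have "?\<gamma> \<le> \<gamma>bar"
  proof (cases "t = 1")
    case True
    then show ?thesis
      using assms(8) by simp
  next
    case False
    then show ?thesis
      using sol \<open>t \<ge> 1\<close> by (simp add: sdp_feasible_def)
  qed
  with \<gamma>_pos have \<eta>: "1 \<le> \<eta>" "\<eta> * ?\<gamma> = \<gamma>bar" and inv_\<eta>: "1 / \<eta> = ?\<gamma> / \<gamma>bar"
    using \<open>\<eta> = \<gamma>bar / ?\<gamma>\<close> by simp_all

  have congruence: "(hcat X W ** ?N) ** matrix_inv ?P ** transpose (hcat X W ** ?N)
      = hcat X W ** M ** transpose (hcat X W)" for X :: "real^'n^'n" and W :: "real^'m^'n"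
    unfolding \<open>M = _\<close> by (simp add: matrix_transpose_mul matrix_mul_assoc)
  have change: "(A (x t) ** ?P + B (x t) ** ?Y) ** matrix_inv ?P
        ** transpose (A (x t) ** ?P + B (x t) ** ?Y)
      = (?A ** ?P + ?B ** ?Y) ** matrix_inv ?P ** transpose (?A ** ?P + ?B ** ?Y) + \<Psi>"
  proof -
    have "Z t ** M ** transpose (Z t) = Z (t - 1) ** M ** transpose (Z (t - 1)) + \<Psi>"
      using congruence_perturbation[of "Z (t - 1)" R M] \<open>R = _\<close> \<open>\<Psi> = _\<close> by simp
    then show ?thesis
      unfolding assms(10) hcat_mult_vcat[symmetric] congruence .
  qed
  have pull_out_\<eta>: "A (x t) ** (\<eta> *\<^sub>R ?P) + B (x t) ** (\<eta> *\<^sub>R ?Y)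
      = \<eta> *\<^sub>R (A (x t) ** ?P + B (x t) ** ?Y)"
    by (simp add: matrix_scalar_ac scalar_matrix_assoc scaleR_right_distrib)
  have "psd (block (\<eta> *\<^sub>R ?P - mat 1) (A (x t) ** (\<eta> *\<^sub>R ?P) + B (x t) ** (\<eta> *\<^sub>R ?Y))
      (transpose (A (x t) ** (\<eta> *\<^sub>R ?P) + B (x t) ** (\<eta> *\<^sub>R ?Y))) (\<eta> *\<^sub>R ?P))"
    unfolding pull_out_\<eta> using P_pos _ lyap change
  proof (rule psd_scaled_lyapunov_block)
    show "0 < \<eta>"
      using \<eta>(1) by simp
    show "psd ((1 - 1 / \<eta>) *\<^sub>R mat 1 - \<Psi>)"
      using assms(14) unfolding loewner_le_def inv_\<eta> .
  qed
  moreover have "psd (block (\<eta> *\<^sub>R ?L) (\<eta> *\<^sub>R ?Y) (transpose (\<eta> *\<^sub>R ?Y)) (\<eta> *\<^sub>R ?P))"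
    using psd_scaleR[OF cost, of \<eta>] \<eta>(1) by (simp add: scaleR_block transpose_scalar)
  moreover have "trace (\<eta> *\<^sub>R ?P) + trace (\<eta> *\<^sub>R ?L) \<le> \<eta> * ?\<gamma>"
  proof -
    have "trace (\<eta> *\<^sub>R ?P) + trace (\<eta> *\<^sub>R ?L) = \<eta> * (trace ?P + trace ?L)"
      by (simp add: trace_def sum_distrib_left distrib_left)
    then show ?thesis
      using trace \<eta>(1) by simp
  qed
  moreover have "psd (block (rowvector (x t) ** matrix_inv ?P ** columnvector (x t) :: real^1^1)
      (rowvector (x t)) (columnvector (x t)) (\<eta> *\<^sub>R ?P))"
    using P_pos \<eta>(1) by (rule psd_ellipsoid_block)
  ultimately show ?thesis
    using P_sym L_sym \<eta>(2) by (simp add: sdp_feasible_def transpose_scalar)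
qed

end
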